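(* Let $n\ge 1$. The quotient $M(n)$ is arithmetically elementary if and only if $n\mid 24$ or $n$ is prime.
   Context: For a positive integer $n$, $\mathbb Z_n=\mathbb Z/n\mathbb Z$, $\mathbb Z_n^\times$ is its group of units, and $S_n=\{u^2:u\in\mathbb Z_n^\times\}$. $M(n)$ denotes the Marshall quotient of $\mathbb Z_n$ by $S_n$: the underlying set is the quotient of $\mathbb Z_n$ by the equivalence relation $a\sim b\iff as=bt$ for some $s,t\in S_n$; the class of $a$ is written $[a]$. The operations are $[a][b]=[ab]$, $-[a]=[-a]$, and the multivalued addition $[a]+[b]=\{[c]: cr=as+bt\text{ for some }r,s,t\in S_n\}$, with zero $[0]$ and unit $[1]$. $M(n)$ is called arithmetically elementary if either (i) the quotient relation $\sim$ is equality, so that $M(n)=\mathbb Z_n$ as an ordinary multiring (sums being singletons); or (ii) $n$ is prime, so that $M(n)$ is the square-class quotient of a finite field. *)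

theory Defs
  imports "HOL-Algebra.IntRing"
begin

(* The operations are total on the type; only their values on the carrier are meant. *)
record 'a multiring = "'a monoid" +
  mzero :: 'a
  mneg :: "'a \<Rightarrow> 'a"
  madd :: "'a \<Rightarrow> 'a \<Rightarrow> 'a set"

definition marshall_rel :: "('a, 'm) ring_scheme \<Rightarrow> 'a set \<Rightarrow> ('a \<times> 'a) set" where
  "marshall_rel R S = {(a, b). a \<in> carrier R \<and> b \<in> carrier R \<and>
     (\<exists>s\<in>S. \<exists>t\<in>S. a \<otimes>\<^bsub>R\<^esub> s = b \<otimes>\<^bsub>R\<^esub> t)}"

abbreviation marshall_class :: "('a, 'm) ring_scheme \<Rightarrow> 'a set \<Rightarrow> 'a \<Rightarrow> 'a set" where
  "marshall_class R S a \<equiv> marshall_rel R S `` {a}"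

(* The operations run over all representatives of the argument classes; the lemmas
   marshall_mult, marshall_neg and marshall_add show that one choice of
   representatives suffices. *)
definition marshall_quotient :: "('a, 'm) ring_scheme \<Rightarrow> 'a set \<Rightarrow> 'a set multiring" where
  "marshall_quotient R S =
     \<lparr>carrier = carrier R // marshall_rel R S,
      mult = (\<lambda>A B. \<Union>a\<in>A. \<Union>b\<in>B. marshall_class R S (a \<otimes>\<^bsub>R\<^esub> b)),
      one = marshall_class R S \<one>\<^bsub>R\<^esub>,
      mzero = marshall_class R S \<zero>\<^bsub>R\<^esub>,
      mneg = (\<lambda>A. \<Union>a\<in>A. marshall_class R S (\<ominus>\<^bsub>R\<^esub> a)),
      madd = (\<lambda>A B. {marshall_class R S c |c. c \<in> carrier R \<and>
        (\<exists>a\<in>A. \<exists>b\<in>B. \<exists>r\<in>S. \<exists>s\<in>S. \<exists>t\<in>S.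
           c \<otimes>\<^bsub>R\<^esub> r = a \<otimes>\<^bsub>R\<^esub> s \<oplus>\<^bsub>R\<^esub> b \<otimes>\<^bsub>R\<^esub> t)})\<rparr>"

(* ZFact is used rather than residue_ring because residue_ring 1 is not a ring. *)
abbreviation Zmod :: "nat \<Rightarrow> int set ring" where
  "Zmod n \<equiv> ZFact (int n)"

definition unit_squares :: "('a, 'm) ring_scheme \<Rightarrow> 'a set" where
  "unit_squares R = {u \<otimes>\<^bsub>R\<^esub> u |u. u \<in> Units R}"

definition marshall_Zmod :: "nat \<Rightarrow> int set set multiring" where
  "marshall_Zmod n = marshall_quotient (Zmod n) (unit_squares (Zmod n))"

(* That the quotient is then Z/nZ with singleton sums, respectively the square-class quotient of
   a finite field, is a consequence: see marshall_Zmod_eq_Zmod and Zmod_prime_field. *)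
definition arithmetically_elementary :: "nat \<Rightarrow> bool" where
  "arithmetically_elementary n \<longleftrightarrow>
     marshall_rel (Zmod n) (unit_squares (Zmod n)) = Id_on (carrier (Zmod n)) \<or>
     Factorial_Ring.prime n"

locale mult_subset = cring R for R (structure) +
  fixes S
  assumes S_sub: "S \<subseteq> carrier R"
    and S_one: "\<one> \<in> S"
    and S_mult: "\<lbrakk>s \<in> S; t \<in> S\<rbrakk> \<Longrightarrow> s \<otimes> t \<in> S"
begin

lemma S_carr [simp]: "s \<in> S \<Longrightarrow> s \<in> carrier R"
  using S_sub by blast

lemma rel_iff:
  "(a, b) \<in> marshall_rel R S \<longleftrightarrow>
     a \<in> carrier R \<and> b \<in> carrier R \<and> (\<exists>s\<in>S. \<exists>t\<in>S. a \<otimes> s = b \<otimes> t)"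
  by (auto simp: marshall_rel_def)

lemma equiv_marshall_rel: "equiv (carrier R) (marshall_rel R S)"
proof (rule equivI)
  show "marshall_rel R S \<subseteq> carrier R \<times> carrier R"
    by (auto simp: marshall_rel_def)
  show "refl_on (carrier R) (marshall_rel R S)"
    using S_one by (auto simp: refl_on_def rel_iff)
  show "sym (marshall_rel R S)"
    by (rule symI) (metis rel_iff)
  show "trans (marshall_rel R S)"
  proof (rule transI)
    fix a b c
    assume "(a, b) \<in> marshall_rel R S" "(b, c) \<in> marshall_rel R S"
    then obtain s t s' t' where c: "a \<in> carrier R" "b \<in> carrier R" "c \<in> carrier R"
      and S: "s \<in> S" "t \<in> S" "s' \<in> S" "t' \<in> S"
      and e: "a \<otimes> s = b \<otimes> t" "b \<otimes> s' = c \<otimes> t'"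
      unfolding rel_iff by blast
    have "a \<otimes> (s \<otimes> s') = (a \<otimes> s) \<otimes> s'"
      using c S by (simp add: m_assoc)
    also have "\<dots> = (b \<otimes> s') \<otimes> t"
      unfolding e(1) using c S by (simp add: m_ac)
    also have "\<dots> = c \<otimes> (t' \<otimes> t)"
      unfolding e(2) using c S by (simp add: m_assoc)
    finally show "(a, c) \<in> marshall_rel R S"
      unfolding rel_iff using c S S_mult by blast
  qed
qed

lemma rel_mult:
  assumes "(a, a') \<in> marshall_rel R S" "(b, b') \<in> marshall_rel R S"
  shows "(a \<otimes> b, a' \<otimes> b') \<in> marshall_rel R S"
proof -
  obtain s t s' t' where c: "a \<in> carrier R" "a' \<in> carrier R" "b \<in> carrier R" "b' \<in> carrier R"
    and S: "s \<in> S" "t \<in> S" "s' \<in> S" "t' \<in> S"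
    and e: "a \<otimes> s = a' \<otimes> t" "b \<otimes> s' = b' \<otimes> t'"
    using assms unfolding rel_iff by blast
  have "(a \<otimes> b) \<otimes> (s \<otimes> s') = (a \<otimes> s) \<otimes> (b \<otimes> s')"
    using c S by (simp add: m_ac)
  also have "\<dots> = (a' \<otimes> b') \<otimes> (t \<otimes> t')"
    unfolding e using c S by (simp add: m_ac)
  finally show ?thesis
    unfolding rel_iff using c S S_mult by blast
qed

lemma rel_neg:
  assumes "(a, a') \<in> marshall_rel R S"
  shows "(\<ominus> a, \<ominus> a') \<in> marshall_rel R S"
  using assms unfolding rel_iff by (metis S_carr l_minus a_inv_closed)

lemma marshall_mult:
  assumes "a \<in> carrier R" "b \<in> carrier R"
  shows "marshall_class R S a \<otimes>\<^bsub>marshall_quotient R S\<^esub> marshall_class R S b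
       = marshall_class R S (a \<otimes> b)"
proof -
  have "congruent2 (marshall_rel R S) (marshall_rel R S) (\<lambda>a b. marshall_class R S (a \<otimes> b))"
    by (intro congruent2I' equiv_class_eq[OF equiv_marshall_rel] rel_mult)
  from UN_equiv_class2[OF equiv_marshall_rel equiv_marshall_rel this assms] show ?thesis
    by (simp only: marshall_quotient_def monoid.simps multiring.simps)
qed

lemma marshall_neg:
  assumes "a \<in> carrier R"
  shows "mneg (marshall_quotient R S) (marshall_class R S a) = marshall_class R S (\<ominus> a)"
proof -
  have "congruent (marshall_rel R S) (\<lambda>a. marshall_class R S (\<ominus> a))"
    by (intro congruentI equiv_class_eq[OF equiv_marshall_rel] rel_neg)
  from UN_equiv_class[OF equiv_marshall_rel this assms] show ?thesis
    by (simp only: marshall_quotient_def multiring.simps)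
qed

lemma marshall_add:
  assumes "a \<in> carrier R" "b \<in> carrier R"
  shows "madd (marshall_quotient R S) (marshall_class R S a) (marshall_class R S b)
       = {marshall_class R S c |c. c \<in> carrier R \<and>
            (\<exists>r\<in>S. \<exists>s\<in>S. \<exists>t\<in>S. c \<otimes> r = a \<otimes> s \<oplus> b \<otimes> t)}"
    (is "?L = ?R")
proof
  have refl: "a \<in> marshall_class R S a" "b \<in> marshall_class R S b"
    using assms by (simp_all only: equiv_class_self[OF equiv_marshall_rel])
  have L: "?L = {marshall_class R S c |c. c \<in> carrier R \<and>
        (\<exists>a'\<in>marshall_class R S a. \<exists>b'\<in>marshall_class R S b. \<exists>r\<in>S. \<exists>s\<in>S. \<exists>t\<in>S.
           c \<otimes> r = a' \<otimes> s \<oplus> b' \<otimes> t)}"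
    by (simp only: marshall_quotient_def multiring.simps)
  show "?R \<subseteq> ?L"
    unfolding L using refl by blast
  have "\<exists>r\<in>S. \<exists>s\<in>S. \<exists>t\<in>S. c \<otimes> r = a \<otimes> s \<oplus> b \<otimes> t"
    if h: "c \<in> carrier R" "a' \<in> marshall_class R S a" "b' \<in> marshall_class R S b"
      "r \<in> S" "s \<in> S" "t \<in> S" "c \<otimes> r = a' \<otimes> s \<oplus> b' \<otimes> t" for c a' b' r s t
  proof -
    obtain s1 t1 s2 t2 where c: "a' \<in> carrier R" "b' \<in> carrier R"
      and S: "s1 \<in> S" "t1 \<in> S" "s2 \<in> S" "t2 \<in> S"
      and e: "a \<otimes> t1 = a' \<otimes> s1" "b \<otimes> t2 = b' \<otimes> s2"
      using h(2,3) unfolding Image_singleton_iff rel_iff by blast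
    have "c \<otimes> (r \<otimes> (s1 \<otimes> s2)) = (c \<otimes> r) \<otimes> (s1 \<otimes> s2)"
      using h(1,4) S by (simp add: m_assoc)
    also have "\<dots> = (a' \<otimes> s1) \<otimes> (s \<otimes> s2) \<oplus> (b' \<otimes> s2) \<otimes> (t \<otimes> s1)"
      unfolding h(7) using h(4-6) c S by (simp add: l_distr r_distr m_ac)
    also have "\<dots> = a \<otimes> (t1 \<otimes> (s \<otimes> s2)) \<oplus> b \<otimes> (t2 \<otimes> (t \<otimes> s1))"
      unfolding e[symmetric] using assms h(5,6) S by (simp add: m_assoc)
    finally have "c \<otimes> (r \<otimes> (s1 \<otimes> s2))
        = a \<otimes> (t1 \<otimes> (s \<otimes> s2)) \<oplus> b \<otimes> (t2 \<otimes> (t \<otimes> s1))" .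
    moreover have S': "r \<otimes> (s1 \<otimes> s2) \<in> S" "t1 \<otimes> (s \<otimes> s2) \<in> S" "t2 \<otimes> (t \<otimes> s1) \<in> S"
      by (intro S_mult h S)+
    ultimately show ?thesis
      by (rule_tac bexI[OF _ S'(1)], rule_tac bexI[OF _ S'(2)], rule_tac bexI[OF _ S'(3)])
  qed
  note key = this
  show "?L \<subseteq> ?R"
  proof
    fix C assume "C \<in> ?L"
    then obtain c a' b' r s t where h: "c \<in> carrier R" "a' \<in> marshall_class R S a"
      "b' \<in> marshall_class R S b" "r \<in> S" "s \<in> S" "t \<in> S"
      "c \<otimes> r = a' \<otimes> s \<oplus> b' \<otimes> t" and C: "C = marshall_class R S c"
      unfolding L by blast
    show "C \<in> ?R"
      unfolding C using key[OF h] h(1) by blast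
  qed
qed

lemma marshall_trivial:
  assumes "marshall_rel R S = Id_on (carrier R)"
  shows "bij_betw (\<lambda>a. {a}) (carrier R) (carrier (marshall_quotient R S))"
    and "\<one>\<^bsub>marshall_quotient R S\<^esub> = {\<one>}"
    and "mzero (marshall_quotient R S) = {\<zero>}"
    and "a \<in> carrier R \<Longrightarrow> mneg (marshall_quotient R S) {a} = {\<ominus> a}"
    and "\<lbrakk>a \<in> carrier R; b \<in> carrier R\<rbrakk> \<Longrightarrow> {a} \<otimes>\<^bsub>marshall_quotient R S\<^esub> {b} = {a \<otimes> b}"
    and "\<lbrakk>a \<in> carrier R; b \<in> carrier R\<rbrakk> \<Longrightarrow> madd (marshall_quotient R S) {a} {b} = {{a \<oplus> b}}"
proof -
  have cl: "marshall_class R S a = {a}" if "a \<in> carrier R" for a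
    using that assms by auto
  have S1: "S = {\<one>}"
  proof -
    have "s = \<one>" if "s \<in> S" for s
    proof -
      have "(s, \<one>) \<in> marshall_rel R S"
        unfolding rel_iff using that S_one by (metis S_carr one_closed m_comm)
      then show ?thesis using assms by auto
    qed
    then show ?thesis using S_one by blast
  qed
  show "bij_betw (\<lambda>a. {a}) (carrier R) (carrier (marshall_quotient R S))"
    unfolding bij_betw_def marshall_quotient_def quotient_def using cl by auto
  show "\<one>\<^bsub>marshall_quotient R S\<^esub> = {\<one>}" "mzero (marshall_quotient R S) = {\<zero>}"
    unfolding marshall_quotient_def using cl by simp_all
  show "mneg (marshall_quotient R S) {a} = {\<ominus> a}" if "a \<in> carrier R"
    using marshall_neg[OF that] that cl by simp
  show "{a} \<otimes>\<^bsub>marshall_quotient R S\<^esub> {b} = {a \<otimes> b}" if "a \<in> carrier R" "b \<in> carrier R"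
    using marshall_mult[OF that] that cl by simp
  show "madd (marshall_quotient R S) {a} {b} = {{a \<oplus> b}}" if "a \<in> carrier R" "b \<in> carrier R"
  proof -
    have "{marshall_class R S c |c. c \<in> carrier R \<and>
            (\<exists>r\<in>S. \<exists>s\<in>S. \<exists>t\<in>S. c \<otimes> r = a \<otimes> s \<oplus> b \<otimes> t)}
        = {marshall_class R S c |c. c = a \<oplus> b}"
      using that by (intro Collect_cong ex_cong1) (auto simp: S1 simp del: Image_singleton_iff)
    then show ?thesis
      using marshall_add[OF that] that by (simp add: cl del: Image_singleton_iff)
  qed
qed

end

lemma (in cring) mult_subset_unit_squares: "mult_subset R (unit_squares R)"
proof unfold_locales
  show "unit_squares R \<subseteq> carrier R"
    by (auto simp: unit_squares_def)
  show "\<one> \<in> unit_squares R"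
    unfolding unit_squares_def using Units_one_closed by force
  fix s t assume "s \<in> unit_squares R" "t \<in> unit_squares R"
  then obtain u v where "u \<in> Units R" "v \<in> Units R" "s = u \<otimes> u" "t = v \<otimes> v"
    by (auto simp: unit_squares_def)
  then have "s \<otimes> t = (u \<otimes> v) \<otimes> (u \<otimes> v)" "u \<otimes> v \<in> Units R"
    by (simp_all add: Units_closed m_ac)
  then show "s \<otimes> t \<in> unit_squares R"
    by (auto simp: unit_squares_def)
qed

interpretation Zmod: mult_subset "Zmod n" "unit_squares (Zmod n)" for n
  by (rule cring.mult_subset_unit_squares[OF ZFact_is_cring])

lemmas marshall_Zmod_mult = Zmod.marshall_mult[folded marshall_Zmod_def]
  and marshall_Zmod_neg = Zmod.marshall_neg[folded marshall_Zmod_def]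
  and marshall_Zmod_add = Zmod.marshall_add[folded marshall_Zmod_def]
  and marshall_Zmod_eq_Zmod = Zmod.marshall_trivial[folded marshall_Zmod_def]

lemma finite_Zmod:
  assumes "n > 0"
  shows "finite (carrier (Zmod n))"
proof -
  have "carrier (Zmod n) = range (ZMod (int n))"
    unfolding ZFact_defs A_RCOSETS_defs r_coset_def ZMod_def by (auto simp: a_r_coset_def r_coset_def)
  also have "\<dots> \<subseteq> ZMod (int n) ` {0..<int n}"
  proof
    fix x assume "x \<in> range (ZMod (int n))"
    then obtain a where "x = ZMod (int n) a" by blast
    then have "x = ZMod (int n) (a mod int n)" using ZMod_mod by simp
    then show "x \<in> ZMod (int n) ` {0..<int n}" using assms by simp
  qed
  finally show ?thesis by (rule finite_subset) simp
qed

lemma (in domain) finite_domain_field: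
  assumes "finite (carrier R)"
  shows "Ring.field R"
proof (rule cring_fieldI2)
  show "\<zero> \<noteq> \<one>"
    using one_not_zero by simp
  fix a assume a: "a \<in> carrier R" "a \<noteq> \<zero>"
  have "inj_on ((\<otimes>) a) (carrier R)"
    using a by (auto intro!: inj_onI simp: m_lcancel)
  moreover have "(\<otimes>) a ` carrier R \<subseteq> carrier R"
    using a by auto
  ultimately have "(\<otimes>) a ` carrier R = carrier R"
    using assms by (intro endo_inj_surj)
  then have "\<one> \<in> (\<otimes>) a ` carrier R"
    by simp
  then show "\<exists>b\<in>carrier R. a \<otimes> b = \<one>"
    by auto
qed

lemma Zmod_prime_field:
  assumes "Factorial_Ring.prime n"
  shows "Ring.field (Zmod n)" "finite (carrier (Zmod n))"
proof -
  show fin: "finite (carrier (Zmod n))"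
    using assms finite_Zmod prime_gt_0_nat by blast
  have "domain (Zmod n)"
    using assms ZFact_prime_is_domain[of "int n"] by simp
  then show "Ring.field (Zmod n)"
    using fin by (rule domain.finite_domain_field)
qed

end

theory Submission
  imports Defs "HOL-Number_Theory.Cong"
begin

text \<open>
  The relation \<open>\<sim>\<close> identifies every square of a unit with \<open>1\<close>, so it is equality
  exactly when \<open>1\<close> is the only such square (\<open>marshall_rel_eq_Id_on_iff\<close>). As the units of
  \<open>\<int>/k\<close> are the residues coprime to \<open>k\<close>, this says that \<open>k\<close> divides \<open>a\<^sup>2 - 1\<close> for all
  \<open>a\<close> coprime to \<open>k\<close> (\<open>unit_squares_ZFact_trivial_iff\<close>). The case of a prime modulus is
  an alternative on both sides, so it remains to show that the positive moduli with this property are the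
  divisors of \<open>24\<close>.

  If a modulus \<open>p ^ j * m\<close> with \<open>\<not> p dvd m\<close> has the property, then the unit \<open>p + m\<close> shows that
  \<open>m\<close> divides \<open>p\<^sup>2 - 1\<close> (\<open>dvd_square_minus_one_of_squares\<close>). The primes \<open>2\<close> and \<open>3\<close> bound the
  odd part by \<open>3\<close> and the part prime to \<open>3\<close> by \<open>8\<close>, hence the modulus divides \<open>24\<close>.
  Conversely, \<open>8\<close> divides \<open>a\<^sup>2 - 1\<close> for odd \<open>a\<close>, and \<open>3\<close> divides it when \<open>3\<close> does not
  divide \<open>a\<close>; together these settle every divisor of \<open>24\<close>.
\<close>

lemma (in mult_subset) marshall_rel_eq_Id_on_iff:
  "marshall_rel R S = Id_on (carrier R) \<longleftrightarrow> S = {\<one>}"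
proof
  assume triv: "marshall_rel R S = Id_on (carrier R)"
  have "s = \<one>" if "s \<in> S" for s
  proof -
    have "(s, \<one>) \<in> marshall_rel R S"
      unfolding rel_iff using that S_one by (metis S_carr one_closed m_comm)
    then show ?thesis using triv by auto
  qed
  then show "S = {\<one>}" using S_one by blast
next
  assume "S = {\<one>}"
  then show "marshall_rel R S = Id_on (carrier R)"
    by (auto simp: marshall_rel_def)
qed

lemma ZMod_hom: "ZMod k \<in> ring_hom \<Z> (ZFact k)"
  unfolding ZMod_def ZFact_def
  by (rule ideal.rcos_ring_hom[OF int.genideal_ideal]) simp

lemma ZMod_mult: "ZMod k a \<otimes>\<^bsub>ZFact k\<^esub> ZMod k b = ZMod k (a * b)"
  using ring_hom_mult[OF ZMod_hom, of a b k] by simp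

lemma ZMod_one: "\<one>\<^bsub>ZFact k\<^esub> = ZMod k 1"
  using ring_hom_one[OF ZMod_hom, of k] by simp

lemma carrier_ZFact: "carrier (ZFact k) = range (ZMod k)"
  unfolding ZFact_defs A_RCOSETS_defs r_coset_def ZMod_def
  by (auto simp: a_r_coset_def r_coset_def)

lemma Units_ZFact: "Units (ZFact k) = ZMod k ` {a. coprime a k}"
proof -
  have "ZMod k a \<in> Units (ZFact k) \<longleftrightarrow> coprime a k" for a
  proof -
    have "ZMod k a \<in> Units (ZFact k) \<longleftrightarrow> (\<exists>b. ZMod k (a * b) = ZMod k 1)"
      unfolding Units_def
      by (auto simp: carrier_ZFact ZMod_mult ZMod_one mult.commute)
    also have "\<dots> \<longleftrightarrow> (\<exists>b. [a * b = 1] (mod k))"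
      by (simp add: ZMod_eq_mod cong_def)
    also have "\<dots> \<longleftrightarrow> coprime a k"
      by (simp add: coprime_iff_invertible_int)
    finally show ?thesis .
  qed
  moreover have "Units (ZFact k) \<subseteq> range (ZMod k)"
    by (auto simp: Units_def carrier_ZFact)
  ultimately show ?thesis by auto
qed

lemma unit_squares_ZFact_trivial_iff:
  "unit_squares (ZFact k) = {\<one>\<^bsub>ZFact k\<^esub>} \<longleftrightarrow> (\<forall>a. coprime a k \<longrightarrow> k dvd a\<^sup>2 - 1)"
proof -
  have "unit_squares (ZFact k) = (\<lambda>a. ZMod k (a\<^sup>2)) ` {a. coprime a k}"
    unfolding unit_squares_def Units_ZFact
    by (auto simp: ZMod_mult power2_eq_square intro!: exI[of _ "ZMod k _"])
  moreover have "f ` {a. coprime a k} = {c} \<longleftrightarrow> (\<forall>a. coprime a k \<longrightarrow> f a = c)"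
    for f :: "int \<Rightarrow> int set" and c
    using coprime_1_left[of k] by blast
  ultimately have "unit_squares (ZFact k) = {\<one>\<^bsub>ZFact k\<^esub>}
      \<longleftrightarrow> (\<forall>a. coprime a k \<longrightarrow> ZMod k (a\<^sup>2) = ZMod k 1)"
    by (simp only: ZMod_one)
  then show ?thesis
    by (simp add: ZMod_eq_mod mod_eq_dvd_iff)
qed

text \<open>
  The element \<open>p + m\<close> is coprime to both \<open>p\<close> and \<open>m\<close> and congruent to \<open>p\<close> modulo \<open>m\<close>, so it
  turns \<open>p\<close>, which may fail to be a unit for the full modulus, into a unit with the same square
  modulo \<open>m\<close>.
\<close>
lemma dvd_square_minus_one_of_squares:
  fixes p :: int and m :: int
  assumes "prime p" and "\<not> p dvd m"
    and sq: "\<And>a. coprime a (p ^ j * m) \<Longrightarrow> p ^ j * m dvd a\<^sup>2 - 1"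
  shows "m dvd p\<^sup>2 - 1"
proof -
  have "coprime p m" using assms prime_imp_coprime by blast
  then have "coprime (p + m) m" "coprime (p + m) p"
    by (simp_all add: coprime_iff_gcd_eq_1 gcd.commute[of p] gcd.commute[of "p + m"])
  then have "coprime (p + m) (p ^ j * m)" by simp
  then have "m dvd (p + m)\<^sup>2 - 1" using sq dvd_mult_right by blast
  moreover have "(p + m)\<^sup>2 - 1 = p\<^sup>2 - 1 + m * (2 * p + m)"
    by (simp add: algebra_simps power2_eq_square)
  ultimately show ?thesis by (simp add: dvd_add_left_iff)
qed

text \<open>
  The primes \<open>2\<close> and \<open>3\<close> suffice because \<open>2\<^sup>2 - 1 = 3\<close> and \<open>3\<^sup>2 - 1 = 8\<close> are powers of each
  other's prime: the first bounds the \<open>3\<close>-part of the modulus and the second all the rest.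
\<close>
lemma dvd_24_of_squares:
  fixes k :: int
  assumes "k \<noteq> 0" and sq: "\<And>a. coprime a k \<Longrightarrow> k dvd a\<^sup>2 - 1"
  shows "k dvd 24"
proof -
  obtain m where m: "\<not> 2 dvd m" "k = 2 ^ multiplicity 2 k * m"
    using multiplicity_decompose'[of k 2] \<open>k \<noteq> 0\<close> by auto
  obtain q where q: "\<not> 3 dvd q" "k = 3 ^ multiplicity 3 k * q"
    using multiplicity_decompose'[of k 3] \<open>k \<noteq> 0\<close> by auto
  have m3: "m dvd 3"
    using dvd_square_minus_one_of_squares[of 2 m "multiplicity 2 k"] sq m by simp
  have q8: "q dvd 8"
    using dvd_square_minus_one_of_squares[of 3 q "multiplicity 3 k"] sq q by simp
  have "3 ^ multiplicity 3 k dvd 2 ^ multiplicity 2 k * m"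
    using m(2) multiplicity_dvd by metis
  moreover have "coprime (3 ^ multiplicity 3 k) (2 ^ multiplicity 2 k :: int)" by simp
  ultimately have "3 ^ multiplicity 3 k dvd m"
    using coprime_dvd_mult_right_iff by blast
  then have "3 ^ multiplicity 3 k * q dvd 3 * 8"
    using m3 q8 by (intro mult_dvd_mono) (auto intro: dvd_trans)
  then show ?thesis using q(2) by simp
qed

text \<open>
  A divisor of \<open>p ^ j\<close> that is coprime to a multiple of \<open>p\<close> is a unit. So in testing whether a
  divisor of a prime power divides an expression in \<open>a\<close>, only those \<open>a\<close> prime to \<open>p\<close> matter,
  and for these the full prime power can be tested.
\<close>
lemma dvd_of_dvd_prime_power:
  fixes p a x y :: "'a :: factorial_semiring_gcd"
  assumes "prime p" "x dvd p ^ j" "coprime a x" and "\<not> p dvd a \<Longrightarrow> p ^ j dvd y"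
  shows "x dvd y"
proof (cases "p dvd a")
  case True
  then have "coprime (p ^ j) x"
    using \<open>coprime a x\<close> coprime_divisors[OF True dvd_refl] by simp
  then have "is_unit x"
    using \<open>x dvd p ^ j\<close> by (meson coprime_common_divisor dvd_refl)
  then show ?thesis by (rule unit_imp_dvd)
next
  case False
  then show ?thesis using assms(2,4) dvd_trans by blast
qed

lemma squares_of_dvd_24:
  fixes a :: int
  assumes "k dvd 24" "coprime a k"
  shows "k dvd a\<^sup>2 - 1"
proof -
  have "k dvd 2 ^ 3 * 3 ^ 1" using assms by simp
  then obtain x y where k: "k = x * y" "x dvd 2 ^ 3" "y dvd 3 ^ 1"
    using division_decomp by blast
  have xa: "coprime a x" and ya: "coprime a y"
    using assms(2) k(1) by simp_all
  have "x dvd a\<^sup>2 - 1"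
  proof (rule dvd_of_dvd_prime_power[OF _ k(2) xa])
    assume "\<not> 2 dvd a"
    then obtain b where b: "a = 2 * b + 1" by (elim oddE)
    \<comment> \<open>\<open>a\<^sup>2 - 1 = 4 * (b * (b + 1))\<close>, and one of two consecutive integers is even.\<close>
    have "2 dvd b * (b + 1)" by simp
    then have "4 * 2 dvd 4 * (b * (b + 1))" by (rule mult_dvd_mono[OF dvd_refl])
    then show "2 ^ 3 dvd a\<^sup>2 - 1"
      by (simp add: b power2_eq_square algebra_simps)
  qed simp
  moreover have "y dvd a\<^sup>2 - 1"
  proof (rule dvd_of_dvd_prime_power[OF _ k(3) ya])
    assume "\<not> 3 dvd a"
    then have "3 dvd a - 1 \<or> 3 dvd a + 1" by presburger
    then have "3 dvd (a - 1) * (a + 1)" by auto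
    then show "3 ^ 1 dvd a\<^sup>2 - 1"
      by (simp add: power2_eq_square algebra_simps)
  qed simp
  moreover have "coprime x y"
    by (rule coprime_divisors[OF k(2,3)])
      (simp only: coprime_power_left_iff coprime_power_right_iff, simp)
  ultimately show ?thesis
    unfolding k(1) by (intro divides_mult)
qed

theorem theorem5p3:
  fixes n :: nat
  assumes "n \<ge> 1"
  shows "arithmetically_elementary n \<longleftrightarrow> n dvd 24 \<or> Factorial_Ring.prime n"
proof -
  have "marshall_rel (Zmod n) (unit_squares (Zmod n)) = Id_on (carrier (Zmod n))
      \<longleftrightarrow> (\<forall>a. coprime a (int n) \<longrightarrow> int n dvd a\<^sup>2 - 1)"
    by (simp only: Zmod.marshall_rel_eq_Id_on_iff unit_squares_ZFact_trivial_iff)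
  also have "\<dots> \<longleftrightarrow> int n dvd int 24"
    using assms dvd_24_of_squares[of "int n"] squares_of_dvd_24[of "int n"] by auto
  finally show ?thesis
    unfolding arithmetically_elementary_def by (simp only: int_dvd_int_iff)
qed

end
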